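(* Let $n,q$ be positive integers. A permutation $\pi\in S_{n+q-1}$ avoids all the patterns in $Pat(q)$ if and only if $Del_q(\pi)-1=Des_q(\pi)$; that is, $$Avoid_q(n+q-1)=\{\pi\in S_{n+q-1}\mid Del_q(\pi)-1=Des_q(\pi)\}.$$
   Context: Let $m=n+q-1$ and write $\pi\in S_m$ as $[\pi(1),\dots,\pi(m)]$. $Del_q(\pi)=\{ i \mid q+1\le i\le m,\ \#\{j<i\mid \pi(j)<\pi(i)\}\le q-1\}$, and $Del_q(\pi)-1=\{i-1\mid i\in Del_q(\pi)\}$. $Des_q(\pi)$, the $q$-descent set, is the set of $i$ with $q\le i\le m-1$ such that $\pi(i)>\pi(i+1)$ or $i+1\in Del_q(\pi)$ (or both). $Pat(q)=\{(\sigma_1-\sigma_2-\cdots-\sigma_q-(q+2)(q+1))\mid \sigma\in S_q\}$ is a set of $q!$ dashed patterns. A permutation $\pi\in S_m$ contains the pattern $(\sigma_1-\sigma_2-\cdots-\sigma_q-(q+2)(q+1))$ if there are positions $1\le i_1<i_2<\cdots<i_q<i_{q+1}<m$ such that the sequence $\pi(i_1),\dots,\pi(i_q),\pi(i_{q+1}),\pi(i_{q+1}+1)$ is order-isomorphic to $\sigma_1,\dots,\sigma_q,q+2,q+1$ (the last two entries must be in adjacent positions); otherwise $\pi$ avoids the pattern. $Avoid_q(m)$ is the set of permutations in $S_m$ avoiding all $q!$ patterns in $Pat(q)$. For example $Pat(1)=\{(1-32)\}$. *)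

theory Defs
  imports "HOL-Combinatorics.Permutations"
begin

text \<open>
  A permutation in \<open>S\<^sub>m\<close> is a function \<open>\<pi> :: nat \<Rightarrow> nat\<close> with \<open>\<pi> permutes {1..m}\<close>;
  positions and values are numbered from 1, as in the notation \<open>[\<pi>(1), \<dots>, \<pi>(m)]\<close>.
\<close>

definition Del :: "nat \<Rightarrow> nat \<Rightarrow> (nat \<Rightarrow> nat) \<Rightarrow> nat set" where
  "Del q m \<pi> = {i. q + 1 \<le> i \<and> i \<le> m \<and> card {j \<in> {1..<i}. \<pi> j < \<pi> i} \<le> q - 1}"

definition Des :: "nat \<Rightarrow> nat \<Rightarrow> (nat \<Rightarrow> nat) \<Rightarrow> nat set" where
  "Des q m \<pi> = {i. q \<le> i \<and> i \<le> m - 1 \<and> (\<pi> i > \<pi> (i + 1) \<or> i + 1 \<in> Del q m \<pi>)}"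

text \<open>
  A dashed pattern is the list of its maximal dash-free blocks: \<open>1-32\<close> is \<open>[[1], [3, 2]]\<close>.
\<close>

type_synonym dashed_pattern = "nat list list"

definition order_isomorphic :: "nat list \<Rightarrow> nat list \<Rightarrow> bool" where
  "order_isomorphic xs ys \<longleftrightarrow> length xs = length ys \<and>
     (\<forall>a<length xs. \<forall>b<length xs. xs ! a < xs ! b \<longleftrightarrow> ys ! a < ys ! b)"

text \<open>
  The positions occupied when the blocks of \<open>p\<close> start at the positions listed in \<open>starts\<close>;
  each block occupies consecutive positions.
\<close>

definition block_positions :: "dashed_pattern \<Rightarrow> nat list \<Rightarrow> nat list" where
  "block_positions p starts = concat (map2 (\<lambda>s b. [s..<s + length b]) starts p)"

definition contains_pattern :: "nat \<Rightarrow> (nat \<Rightarrow> nat) \<Rightarrow> dashed_pattern \<Rightarrow> bool" where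
  "contains_pattern m \<pi> p \<longleftrightarrow> (\<exists>starts. length starts = length p \<and>
     sorted_wrt (<) (block_positions p starts) \<and>
     set (block_positions p starts) \<subseteq> {1..m} \<and>
     order_isomorphic (map \<pi> (block_positions p starts)) (concat p))"

definition Pat :: "nat \<Rightarrow> dashed_pattern set" where
  "Pat q = {map (\<lambda>k. [\<sigma> k]) [1..<q + 1] @ [[q + 2, q + 1]] | \<sigma>. \<sigma> permutes {1..q}}"

definition Avoid :: "nat \<Rightarrow> nat \<Rightarrow> (nat \<Rightarrow> nat) set" where
  "Avoid q m = {\<pi>. \<pi> permutes {1..m} \<and> (\<forall>p\<in>Pat q. \<not> contains_pattern m \<pi> p)}"

lemma Pat_1: "Pat 1 = {[[1], [3, 2]]}"
proof -
  have "\<sigma> = id" if "\<sigma> permutes {1..1::nat}" for \<sigma>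
    using that by simp
  moreover have "id permutes {1..1::nat}" by (rule permutes_id)
  ultimately have "{\<sigma>. \<sigma> permutes {1..1::nat}} = {id}" by blast
  then have "\<sigma> permutes {1..1::nat} \<longleftrightarrow> \<sigma> = id" for \<sigma> by blast
  then show ?thesis by (simp add: Pat_def numeral_eq_Suc)
qed

lemma block_positions_snoc:
  "block_positions (map (\<lambda>k. [\<sigma> k]) ks @ [[a, b]]) (js @ [s]) = js @ [s, s + 1]"
  if "length js = length ks"
  using that
proof (induction js ks rule: list_induct2)
  case Nil
  then show ?case by (simp add: block_positions_def numeral_eq_Suc upt_rec)
next
  case (Cons x xs y ys)
  then show ?case by (simp add: block_positions_def)
qed

lemma contains_pattern_iff:
  fixes q m :: nat and \<pi> \<sigma> :: "nat \<Rightarrow> nat"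
  shows "contains_pattern m \<pi> (map (\<lambda>k. [\<sigma> k]) [1..<q + 1] @ [[q + 2, q + 1]]) \<longleftrightarrow>
    (\<exists>js s. length js = q \<and> sorted_wrt (<) (js @ [s]) \<and> set (js @ [s]) \<subseteq> {1..<m} \<and>
       order_isomorphic (map \<pi> (js @ [s, s + 1])) (map \<sigma> [1..<q + 1] @ [q + 2, q + 1]))"
    (is "?L \<longleftrightarrow> ?R")
proof -
  let ?p = "map (\<lambda>k. [\<sigma> k]) [1..<q + 1] @ [[q + 2, q + 1]]"
  have c: "concat ?p = map \<sigma> [1..<q + 1] @ [q + 2, q + 1]"
    by (simp add: concat_map_singleton)
  have b: "block_positions ?p (js @ [s]) = js @ [s, s + 1]" if "length js = q" for js s
    using that by (intro block_positions_snoc) simp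
  have r: "sorted_wrt (<) (js @ [s, s + 1]) \<and> set (js @ [s, s + 1]) \<subseteq> {1..m} \<longleftrightarrow>
      sorted_wrt (<) (js @ [s]) \<and> set (js @ [s]) \<subseteq> {1..<m}" for js and s :: nat
    by (fastforce simp: sorted_wrt_append)
  have "?L \<longleftrightarrow> (\<exists>js s. length js = q \<and> sorted_wrt (<) (block_positions ?p (js @ [s])) \<and>
     set (block_positions ?p (js @ [s])) \<subseteq> {1..m} \<and>
     order_isomorphic (map \<pi> (block_positions ?p (js @ [s]))) (concat ?p))" (is "_ \<longleftrightarrow> ?M")
  proof
    assume ?L
    then obtain st where st: "length st = length ?p"
      "sorted_wrt (<) (block_positions ?p st)" "set (block_positions ?p st) \<subseteq> {1..m}"
      "order_isomorphic (map \<pi> (block_positions ?p st)) (concat ?p)"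
      unfolding contains_pattern_def by blast
    from st(1) have "length st = Suc q" by simp
    then obtain js s where "st = js @ [s]" "length js = q"
      by (metis length_Suc_conv_rev)
    with st show ?M by blast
  next
    assume ?M
    then obtain js s where M: "length js = q"
      "sorted_wrt (<) (block_positions ?p (js @ [s]))"
      "set (block_positions ?p (js @ [s])) \<subseteq> {1..m}"
      "order_isomorphic (map \<pi> (block_positions ?p (js @ [s]))) (concat ?p)"
      by blast
    from M(1) have "length (js @ [s]) = length ?p" by simp
    with M(2-4) show ?L unfolding contains_pattern_def by blast
  qed
  also have "\<dots> \<longleftrightarrow> ?R" using b r c by (smt (verit, best))
  finally show ?thesis .
qed

end

theory Submission
  imports Defs
begin

text \<open>
  Both sides say the same thing about the descents of \<open>\<pi>\<close>: no descent
  \<open>\<pi> i > \<pi> (i + 1)\<close> is preceded by \<open>q\<close> or more entries below its bottom \<open>\<pi> (i + 1)\<close>.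

  On the pattern side, an occurrence of a pattern in \<open>Pat q\<close> is a descent together with \<open>q\<close>
  earlier entries below its bottom. As \<open>\<sigma>\<close> runs through all of \<open>S\<^sub>q\<close>, the relative order of
  these \<open>q\<close> entries is arbitrary: whatever it is, their standardization is a suitable \<open>\<sigma>\<close>
  (\<open>standardization_exists\<close>). This is \<open>contains_Pat_iff\<close>.

  On the other side, \<open>Del - 1 \<subseteq> Des\<close> always holds, since \<open>Des\<close> contains by definition every
  predecessor of a point of \<open>Del\<close>. Equality therefore means that every descent \<open>i \<ge> q\<close> has
  \<open>i + 1 \<in> Del\<close>, that is, fewer than \<open>q\<close> entries before position \<open>i + 1\<close> are smaller than
  \<open>\<pi> (i + 1)\<close>; the entry at \<open>i\<close> itself is larger, so only positions before \<open>i\<close> count. The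
  bound \<open>i \<ge> q\<close> loses nothing, since fewer than \<open>q\<close> positions precede any \<open>i \<le> q\<close>.
\<close>

text \<open>
  This lets the two parts of a pattern in \<open>Pat q\<close> be matched separately: the final \<open>q + 2, q + 1\<close>
  exceeds everything before it, so only \<open>\<sigma>\<close> constrains the earlier entries.
\<close>

lemma order_isomorphic_append:
  assumes "order_isomorphic xs ys" and "order_isomorphic us vs"
    and "\<forall>x\<in>set xs. \<forall>u\<in>set us. x < u" and "\<forall>y\<in>set ys. \<forall>v\<in>set vs. y < v"
  shows "order_isomorphic (xs @ us) (ys @ vs)"
proof -
  have l: "length xs = length ys" "length us = length vs"
    using assms by (auto simp: order_isomorphic_def)
  have "(xs @ us) ! a < (xs @ us) ! b \<longleftrightarrow> (ys @ vs) ! a < (ys @ vs) ! b"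
    if ab: "a < length (xs @ us)" "b < length (xs @ us)" for a b
  proof (cases "a < length xs"; cases "b < length xs")
    assume "a < length xs" "b < length xs"
    then show ?thesis using assms(1) l by (simp add: order_isomorphic_def nth_append)
  next
    assume c: "a < length xs" "\<not> b < length xs"
    have "xs ! a < us ! (b - length xs)" "ys ! a < vs ! (b - length xs)"
      using assms(3,4) c ab l by auto
    then show ?thesis using c l by (simp add: nth_append)
  next
    assume c: "\<not> a < length xs" "b < length xs"
    have "xs ! b < us ! (a - length xs)" "ys ! b < vs ! (a - length xs)"
      using assms(3,4) c ab l by auto
    then show ?thesis using c l by (simp add: nth_append)
  next
    assume "\<not> a < length xs" "\<not> b < length xs"
    then show ?thesis using assms(2) l ab by (simp add: order_isomorphic_def nth_append)
  qed
  then show ?thesis using l by (simp add: order_isomorphic_def)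
qed

text \<open>
  The permutation replaces each entry by its rank, which is strictly monotone in the entry and
  lies between 1 and the length.
\<close>

lemma standardization_exists:
  assumes "distinct xs"
  obtains \<sigma> where "\<sigma> permutes {1..length xs}"
    and "order_isomorphic xs (map \<sigma> [1..<length xs + 1])"
proof -
  define rank where "rank x = card {y \<in> set xs. y \<le> x}" for x
  define \<sigma> where "\<sigma> k = (if k \<in> {1..length xs} then rank (xs ! (k - 1)) else k)" for k
  have mono: "rank x < rank y" if "x < y" "y \<in> set xs" for x y
  proof -
    have "y \<in> {z \<in> set xs. z \<le> y} - {z \<in> set xs. z \<le> x}" using that by auto
    moreover have "{z \<in> set xs. z \<le> x} \<subseteq> {z \<in> set xs. z \<le> y}" using that by auto
    ultimately have "{z \<in> set xs. z \<le> x} \<subset> {z \<in> set xs. z \<le> y}" by blast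
    then show ?thesis unfolding rank_def by (intro psubset_card_mono) auto
  qed
  then have rank_less_iff: "rank x < rank y \<longleftrightarrow> x < y" if "x \<in> set xs" "y \<in> set xs" for x y
    using that by (metis less_asym less_irrefl linorder_neqE_nat)
  have rank_range: "rank x \<in> {1..length xs}" if "x \<in> set xs" for x
  proof -
    have "{y \<in> set xs. y \<le> x} \<noteq> {}" using that by auto
    then have "rank x \<ge> 1" unfolding rank_def by (simp add: Suc_le_eq card_gt_0_iff)
    moreover have "rank x \<le> card (set xs)" unfolding rank_def by (intro card_mono) auto
    ultimately show ?thesis using card_length[of xs] by auto
  qed
  have "inj_on \<sigma> {1..length xs}"
  proof (rule inj_onI)
    fix k l assume kl: "k \<in> {1..length xs}" "l \<in> {1..length xs}" "\<sigma> k = \<sigma> l"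
    then have i: "k - 1 < length xs" "l - 1 < length xs" by auto
    have "rank (xs ! (k - 1)) = rank (xs ! (l - 1))" using kl by (simp add: \<sigma>_def)
    then have "xs ! (k - 1) = xs ! (l - 1)"
      using rank_less_iff i by (metis less_irrefl linorder_neqE_nat nth_mem)
    then have "k - 1 = l - 1" using assms i by (simp add: nth_eq_iff_index_eq)
    then show "k = l" using kl by auto
  qed
  moreover have "\<sigma> ` {1..length xs} \<subseteq> {1..length xs}"
  proof
    fix y assume "y \<in> \<sigma> ` {1..length xs}"
    then obtain k where "k \<in> {1..length xs}" "y = rank (xs ! (k - 1))"
      by (auto simp: \<sigma>_def)
    moreover from this have "xs ! (k - 1) \<in> set xs" by auto
    ultimately show "y \<in> {1..length xs}" using rank_range by blast
  qed
  ultimately have "bij_betw \<sigma> {1..length xs} {1..length xs}"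
    by (simp add: bij_betw_def endo_inj_surj)
  then have "\<sigma> permutes {1..length xs}"
    by (rule bij_imp_permutes) (auto simp: \<sigma>_def)
  moreover have "map \<sigma> [1..<length xs + 1] = map rank xs"
    by (rule nth_equalityI) (auto simp: \<sigma>_def simp del: upt_Suc)
  then have "order_isomorphic xs (map \<sigma> [1..<length xs + 1])"
    using rank_less_iff by (simp add: order_isomorphic_def)
  ultimately show ?thesis using that by blast
qed

text \<open>
  In a pattern of \<open>Pat q\<close> the letter \<open>q + 1\<close> sits at position \<open>i + 1\<close> and exceeds every letter of
  \<open>\<sigma>\<close>, so an occurrence provides \<open>q\<close> entries below \<open>\<pi> (i + 1)\<close>. Conversely, any \<open>q\<close> of the counted
  positions, in increasing order, carry an occurrence of the pattern whose \<open>\<sigma>\<close> is the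
  standardization of their entries.
\<close>

lemma contains_Pat_iff:
  assumes "\<pi> permutes {1..m}"
  shows "(\<exists>p\<in>Pat q. contains_pattern m \<pi> p) \<longleftrightarrow>
    (\<exists>i\<in>{1..<m}. \<pi> i > \<pi> (i + 1) \<and> q \<le> card {j \<in> {1..<i}. \<pi> j < \<pi> (i + 1)})"
    (is "?L \<longleftrightarrow> ?R")
proof
  assume ?L
  then obtain \<sigma> where \<sigma>: "\<sigma> permutes {1..q}"
    and c: "contains_pattern m \<pi> (map (\<lambda>k. [\<sigma> k]) [1..<q + 1] @ [[q + 2, q + 1]])"
    unfolding Pat_def by blast
  from c[unfolded contains_pattern_iff] obtain js i where js: "length js = q"
    "sorted_wrt (<) (js @ [i])" "set (js @ [i]) \<subseteq> {1..<m}"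
    and iso: "order_isomorphic (map \<pi> (js @ [i, i + 1])) (map \<sigma> [1..<q + 1] @ [q + 2, q + 1])"
    by blast
  let ?u = "map \<pi> (js @ [i, i + 1])" and ?v = "map \<sigma> [1..<q + 1] @ [q + 2, q + 1]"
  have less: "?u ! a < ?u ! b \<longleftrightarrow> ?v ! a < ?v ! b" if "a < q + 2" "b < q + 2" for a b
    using iso js(1) that by (simp add: order_isomorphic_def del: upt_Suc)
  have "\<pi> i > \<pi> (i + 1)"
    using less[of "q + 1" q] js(1) by (simp add: nth_append del: upt_Suc)
  moreover have "\<pi> j < \<pi> (i + 1)" if "j \<in> set js" for j
  proof -
    from that js(1) obtain a where a: "a < q" "j = js ! a" by (metis in_set_conv_nth)
    have "\<sigma> (Suc a) \<in> {1..q}" using a permutes_in_image[OF \<sigma>, of "Suc a"] by auto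
    then show ?thesis
      using less[of a "q + 1"] a js(1) by (simp add: nth_append del: upt_Suc)
  qed
  then have "set js \<subseteq> {j \<in> {1..<i}. \<pi> j < \<pi> (i + 1)}"
    using js(2,3) by (auto simp: sorted_wrt_append)
  then have "card (set js) \<le> card {j \<in> {1..<i}. \<pi> j < \<pi> (i + 1)}"
    by (intro card_mono) auto
  moreover have "card (set js) = q"
    using js(1,2) by (simp add: sorted_wrt_append strict_sorted_iff distinct_card)
  ultimately show ?R using js(3) by auto
next
  assume ?R
  then obtain i where i: "i \<in> {1..<m}" "\<pi> i > \<pi> (i + 1)"
    "q \<le> card {j \<in> {1..<i}. \<pi> j < \<pi> (i + 1)}" by blast
  then obtain T where T: "T \<subseteq> {j \<in> {1..<i}. \<pi> j < \<pi> (i + 1)}" "card T = q" "finite T"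
    by (meson obtain_subset_with_card_n)
  define js where "js = sorted_list_of_set T"
  have js: "set js = T" "length js = q" "sorted_wrt (<) js" "distinct js"
    using T by (auto simp: js_def)
  have "distinct (map \<pi> js)"
    using js(4) permutes_inj[OF assms] by (auto simp: distinct_map intro: inj_on_subset)
  then obtain \<sigma> where \<sigma>: "\<sigma> permutes {1..q}"
    and iso: "order_isomorphic (map \<pi> js) (map \<sigma> [1..<q + 1])"
    using standardization_exists js(2) by (metis length_map)
  have "\<sigma> k < q + 1" if "k \<in> {1..q}" for k
    using that permutes_in_image[OF \<sigma>, of k] by auto
  moreover have "order_isomorphic [\<pi> i, \<pi> (i + 1)] [q + 2, q + 1]"
    using i(2) by (auto simp: order_isomorphic_def less_Suc_eq)
  moreover have "\<forall>x\<in>set (map \<pi> js). \<forall>u\<in>set [\<pi> i, \<pi> (i + 1)]. x < u"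
    using js(1) T(1) i(2) by fastforce
  ultimately have "order_isomorphic (map \<pi> js @ [\<pi> i, \<pi> (i + 1)])
      (map \<sigma> [1..<q + 1] @ [q + 2, q + 1])"
    using iso by (intro order_isomorphic_append) (force simp del: upt_Suc)+
  moreover have "sorted_wrt (<) (js @ [i])" "set (js @ [i]) \<subseteq> {1..<m}"
    using js T(1) i(1) by (auto simp: sorted_wrt_append)
  ultimately have "contains_pattern m \<pi> (map (\<lambda>k. [\<sigma> k]) [1..<q + 1] @ [[q + 2, q + 1]])"
    unfolding contains_pattern_iff using js(2) by (intro exI[of _ js] exI[of _ i]) simp
  then show ?L using \<sigma> unfolding Pat_def by blast
qed

text \<open>
  A point of \<open>Des\<close> outside \<open>Del - 1\<close> is a descent \<open>i\<close> with \<open>i + 1 \<notin> Del\<close>; the right-hand side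
  excludes these. The assumption \<open>q \<ge> 1\<close> makes the truncated bound \<open>\<le> q - 1\<close> in \<open>Del\<close> the same
  as \<open>< q\<close>.
\<close>

lemma Del_pred_eq_Des_iff:
  assumes "q \<ge> 1"
  shows "(\<lambda>i. i - 1) ` Del q m \<pi> = Des q m \<pi> \<longleftrightarrow>
    \<not> (\<exists>i\<in>{1..<m}. \<pi> i > \<pi> (i + 1) \<and> q \<le> card {j \<in> {1..<i}. \<pi> j < \<pi> (i + 1)})"
proof -
  have pred_Del: "i \<in> (\<lambda>i. i - 1) ` Del q m \<pi> \<longleftrightarrow> i + 1 \<in> Del q m \<pi>" for i
    by (force simp: Del_def image_iff)
  then have "(\<lambda>i. i - 1) ` Del q m \<pi> \<subseteq> Des q m \<pi>"
    by (auto simp: Des_def Del_def)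
  then have "(\<lambda>i. i - 1) ` Del q m \<pi> = Des q m \<pi> \<longleftrightarrow>
      (\<forall>i. q \<le> i \<and> i \<le> m - 1 \<and> \<pi> i > \<pi> (i + 1) \<longrightarrow> i + 1 \<in> Del q m \<pi>)"
    using pred_Del unfolding Des_def by blast
  also have "\<dots> \<longleftrightarrow> (\<forall>i\<in>{1..<m}. \<pi> i > \<pi> (i + 1) \<longrightarrow>
      card {j \<in> {1..<i}. \<pi> j < \<pi> (i + 1)} < q)"
  proof -
    have below: "{j \<in> {1..<i + 1}. \<pi> j < \<pi> (i + 1)} = {j \<in> {1..<i}. \<pi> j < \<pi> (i + 1)}"
      if "\<pi> i > \<pi> (i + 1)" for i
      using that by (auto simp: less_Suc_eq)
    have few: "card {j \<in> {1..<i}. \<pi> j < \<pi> (i + 1)} < q" if "1 \<le> i" "i < q" for i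
    proof -
      have "card {j \<in> {1..<i}. \<pi> j < \<pi> (i + 1)} \<le> card {1..<i}" by (intro card_mono) auto
      then show ?thesis using that by simp
    qed
    have Del_iff: "i + 1 \<in> Del q m \<pi> \<longleftrightarrow>
        q \<le> i \<and> i < m \<and> card {j \<in> {1..<i}. \<pi> j < \<pi> (i + 1)} < q" if "\<pi> i > \<pi> (i + 1)" for i
      unfolding Del_def mem_Collect_eq below[OF that] using assms by linarith
    show ?thesis (is "?A \<longleftrightarrow> ?B")
    proof
      assume A: ?A
      show ?B
      proof (intro ballI impI)
        fix i assume i: "i \<in> {1..<m}" "\<pi> i > \<pi> (i + 1)"
        show "card {j \<in> {1..<i}. \<pi> j < \<pi> (i + 1)} < q"
        proof (cases "i < q")
          case True
          then show ?thesis using few i(1) by simp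
        next
          case False
          then have "q \<le> i" "i \<le> m - 1" using i(1) by auto
          then have "i + 1 \<in> Del q m \<pi>" using A i(2) by blast
          then show ?thesis using Del_iff[OF i(2)] by blast
        qed
      qed
    next
      assume B: ?B
      show ?A
      proof (intro allI impI)
        fix i assume i: "q \<le> i \<and> i \<le> m - 1 \<and> \<pi> i > \<pi> (i + 1)"
        then have "i \<in> {1..<m}" using assms by auto
        then show "i + 1 \<in> Del q m \<pi>" using B i Del_iff[of i] by auto
      qed
    qed
  qed
  finally show ?thesis by (auto simp: not_le)
qed

theorem proposition2p4:
  fixes n q :: nat
  assumes "n \<ge> 1" and "q \<ge> 1"
  shows "Avoid q (n + q - 1) =
    {\<pi>. \<pi> permutes {1..n + q - 1} \<and>
        (\<lambda>i. i - 1) ` Del q (n + q - 1) \<pi> = Des q (n + q - 1) \<pi>}"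
  using contains_Pat_iff[of _ "n + q - 1" q] Del_pred_eq_Des_iff[OF assms(2)]
  unfolding Avoid_def by blast

end
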